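(* Let $G$ be a chemical $(n,m)$-graph with $n\ge5$. For real $a\neq0$ put $$P_a=\begin{cases}2^{\frac{a(4m-2n+1)}{3}} & \text{if } 2m-n\equiv1\pmod 3,\\ 2^{\frac{2a(2m-n-2)}{3}}\,3^{a} & \text{if } 2m-n\equiv2\pmod 3,\\ 2^{\frac{2a(2m-n)}{3}} & \text{if } 2m-n\equiv0\pmod 3,\end{cases}\qquad Q_a=\begin{cases}2^{\frac{2a(8m-4n-1)}{3}} & \text{if } 2m-n\equiv1\pmod 3,\\ 2^{\frac{8a(2m-n-2)}{3}}\,3^{3a} & \text{if } 2m-n\equiv2\pmod 3,\\ 2^{\frac{8a(2m-n)}{3}} & \text{if } 2m-n\equiv0\pmod 3.\end{cases}$$ If $a<0$, then $\Pi_{1,a}(G)\le P_a$ and $\Pi_{2,a}(G)\ge Q_a$. If $a>0$, then these inequalities are reversed, that is, $\Pi_{1,a}(G)\ge P_a$ and $\Pi_{2,a}(G)\le Q_a$. Moreover, if $n\ge 11$, then $$\overline{F}(G)\le\begin{cases}2\big(m(5n-26)-n(2n-11)+8\big) & \text{if } 2m-n\equiv1\pmod 3,\\ 2\big(m(5n-26)-n(2n-11)+9\big) & \text{if } 2m-n\equiv2\pmod 3,\\ 2\big(m(5n-26)-2n(n-6)\big) & \text{if } 2m-n\equiv0\pmod 3.\end{cases}$$ In any of these inequalities, equality holds if and only if the degree set of $G$ is - $\{1,2,4\}$ and $G$ contains only one vertex of degree $2$, whenever $2m-n\equiv1\pmod 3$; - $\{1,3,4\}$ and $G$ contains only one vertex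 of degree $3$, whenever $2m-n\equiv2\pmod 3$; - $\{1,4\}$, whenever $2m-n\equiv0\pmod 3$.
   Context: All graphs are finite, simple and connected. An $(n,m)$-graph is a graph with $n$ vertices and $m$ edges. A chemical graph is a (connected) graph of maximum degree at most $4$. $d_v$ denotes the degree of the vertex $v$. The degree set of $G$ is the set of distinct vertex degrees occurring in $G$. For real $a$, the general multiplicative first Zagreb index is $\Pi_{1,a}(G)=\prod_{v\in V(G)}d_v^{\,a}$ and the general multiplicative second Zagreb index is $\Pi_{2,a}(G)=\prod_{v\in V(G)}d_v^{\,a d_v}$. The forgotten topological coindex of a graph $G$ of order $n$ is $\overline{F}(G)=\sum_{v\in V(G)}(n-1-d_v)d_v^2$.
   Formalization: The equality clause is corrected: equality also holds for graphs with degree set {4} (e.g. K5) and for those with degree set {2,4} and only one vertex of degree 2, which the stated degree sets omit; these are added as further equality cases. *)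

theory Defs
  imports Complex_Main
begin

text \<open>A graph is a vertex set together with a set of two-element edges.\<close>

definition simple_graph :: "'v set \<Rightarrow> 'v set set \<Rightarrow> bool" where
  "simple_graph V E \<longleftrightarrow> finite V \<and> (\<forall>e\<in>E. e \<subseteq> V \<and> card e = 2)"

definition adjacency :: "'v set set \<Rightarrow> ('v \<times> 'v) set" where
  "adjacency E = {(u, v). {u, v} \<in> E}"

definition connected_graph :: "'v set \<Rightarrow> 'v set set \<Rightarrow> bool" where
  "connected_graph V E \<longleftrightarrow>
     simple_graph V E \<and> V \<noteq> {} \<and> (\<forall>u\<in>V. \<forall>v\<in>V. (u, v) \<in> (adjacency E)\<^sup>*)"

definition degree :: "'v set set \<Rightarrow> 'v \<Rightarrow> nat" where
  "degree E v = card {e \<in> E. v \<in> e}"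

definition degree_set :: "'v set \<Rightarrow> 'v set set \<Rightarrow> nat set" where
  "degree_set V E = degree E ` V"

definition chemical_graph :: "'v set \<Rightarrow> 'v set set \<Rightarrow> bool" where
  "chemical_graph V E \<longleftrightarrow> connected_graph V E \<and> (\<forall>v\<in>V. degree E v \<le> 4)"

definition Pi1 :: "real \<Rightarrow> 'v set \<Rightarrow> 'v set set \<Rightarrow> real" where
  "Pi1 a V E = (\<Prod>v\<in>V. real (degree E v) powr a)"

definition Pi2 :: "real \<Rightarrow> 'v set \<Rightarrow> 'v set set \<Rightarrow> real" where
  "Pi2 a V E = (\<Prod>v\<in>V. real (degree E v) powr (a * real (degree E v)))"

definition forgotten_coindex :: "'v set \<Rightarrow> 'v set set \<Rightarrow> int" where
  "forgotten_coindex V E =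
     (\<Sum>v\<in>V. (int (card V) - 1 - int (degree E v)) * (int (degree E v))\<^sup>2)"

definition res3 :: "nat \<Rightarrow> nat \<Rightarrow> int" where
  "res3 n m = (2 * int m - int n) mod 3"

definition P_bound :: "real \<Rightarrow> nat \<Rightarrow> nat \<Rightarrow> real" where
  "P_bound a n m =
    (if res3 n m = 1 then 2 powr (a * (4 * real m - 2 * real n + 1) / 3)
     else if res3 n m = 2 then 2 powr (2 * a * (2 * real m - real n - 2) / 3) * 3 powr a
     else 2 powr (2 * a * (2 * real m - real n) / 3))"

definition Q_bound :: "real \<Rightarrow> nat \<Rightarrow> nat \<Rightarrow> real" where
  "Q_bound a n m =
    (if res3 n m = 1 then 2 powr (2 * a * (8 * real m - 4 * real n - 1) / 3)
     else if res3 n m = 2 then 2 powr (8 * a * (2 * real m - real n - 2) / 3) * 3 powr (3 * a)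
     else 2 powr (8 * a * (2 * real m - real n) / 3))"

definition F_bound :: "nat \<Rightarrow> nat \<Rightarrow> int" where
  "F_bound n m =
    (let n' = int n; m' = int m in
     if res3 n m = 1 then 2 * (m' * (5 * n' - 26) - n' * (2 * n' - 11) + 8)
     else if res3 n m = 2 then 2 * (m' * (5 * n' - 26) - n' * (2 * n' - 11) + 9)
     else 2 * (m' * (5 * n' - 26) - 2 * n' * (n' - 6)))"

definition extremal_degrees :: "'v set \<Rightarrow> 'v set set \<Rightarrow> bool" where
  "extremal_degrees V E \<longleftrightarrow>
    (if res3 (card V) (card E) = 1
       then degree_set V E = {1, 2, 4} \<and> card {v \<in> V. degree E v = 2} = 1
     else if res3 (card V) (card E) = 2
       then degree_set V E = {1, 3, 4} \<and> card {v \<in> V. degree E v = 3} = 1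
     else degree_set V E = {1, 4})"

text \<open>
  The degree sets above presuppose a vertex of degree 1. The bounds are also attained by the
  chemical graphs obtained from the same degree patterns when there is no such vertex: the
  4-regular graphs (for instance the complete graph on 5 vertices) and the graphs with one
  vertex of degree 2 and all others of degree 4 (for instance that complete graph with one
  edge subdivided). A characterisation of equality by the predicate above alone is therefore
  false, and these graphs have to be admitted separately. A single vertex of degree 3 with
  all others of degree 4 is impossible, since the degree sum is even.
\<close>

definition extremal_without_leaves :: "'v set \<Rightarrow> 'v set set \<Rightarrow> bool" where
  "extremal_without_leaves V E \<longleftrightarrow>
     degree_set V E = {4} \<or>
     degree_set V E = {2, 4} \<and> card {v \<in> V. degree E v = 2} = 1"

end

theory Submission
  imports Defs
begin

text \<open>
  All three indices are, after taking logarithms for the two products, of the form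
  \<open>\<Sum>v\<in>V. f (degree E v)\<close> with \<open>f\<close> a function of the degrees \<open>1, 2, 3, 4\<close>. Compare \<open>f\<close> with
  the affine function through its values at \<open>1\<close> and \<open>4\<close>. Summed over the vertices, that affine
  function depends only on \<open>n\<close> and on \<open>\<Sum>v\<in>V. degree E v = 2 * m\<close>, so the index is a constant minus
  \<open>c2 * \<alpha> + c3 * \<beta>\<close>, where \<open>c2\<close>, \<open>c3\<close> count the vertices of degree \<open>2\<close> and \<open>3\<close>, and \<open>\<alpha>\<close>, \<open>\<beta>\<close>
  are the amounts by which \<open>f\<close> falls below the affine function at \<open>2\<close> and \<open>3\<close>.

  The two counts are constrained by \<open>c2 + 2 * c3 \<equiv> 2 * m - n\<close> modulo \<open>3\<close>. If
  \<open>\<alpha> < 2 * \<beta>\<close> and \<open>\<beta> < 2 * \<alpha>\<close>, the cheapest way to realise each residue is to use at most one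
  vertex of degree \<open>2\<close> or \<open>3\<close>, and it is the only cheapest way (\<open>residue_cost\<close>). These two
  inequalities hold for \<open>- log 2 d\<close>, because \<open>8 < 9\<close> and \<open>3 < 4\<close>; for \<open>d * log 2 d\<close>, because
  \<open>16 < 27 < 32\<close>; and for \<open>(n - 1 - d) * d\<^sup>2\<close>, because \<open>n \<ge> 11\<close>.
  The two products are powers of \<open>2\<close> whose exponent is \<open>a\<close> times such a sum, so the sign of \<open>a\<close>
  decides the direction of the inequality and \<open>a \<noteq> 0\<close> preserves the cases of equality.

  It remains to read off the degree set when \<open>c2 + c3 \<le> 1\<close> (\<open>at_most_one_middle_iff_extremal\<close>).
  A vertex of degree \<open>4\<close> must exist: otherwise all vertices but one would be leaves, and a connected
  graph of that kind is a star with at most \<open>4\<close> vertices. Leaves may be absent, except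
  that a single vertex of degree \<open>3\<close> among vertices of degree \<open>4\<close> would make the degree sum odd.
\<close>

section \<open>Degrees in a connected graph\<close>

definition degree_count :: "'v set \<Rightarrow> 'v set set \<Rightarrow> nat \<Rightarrow> nat" where
  "degree_count V E i = card {v \<in> V. degree E v = i}"

lemma simple_graph_finite_edges:
  assumes "simple_graph V E"
  shows "finite E"
proof -
  have "E \<subseteq> Pow V" "finite V" using assms by (auto simp: simple_graph_def)
  then show ?thesis by (meson finite_Pow_iff finite_subset)
qed

lemma handshake:
  assumes "simple_graph V E"
  shows "(\<Sum>v\<in>V. degree E v) = 2 * card E"
proof -
  have fin: "finite V" "finite E"
    using assms simple_graph_finite_edges by (auto simp: simple_graph_def)
  have "(\<Sum>v\<in>V. degree E v) = (\<Sum>v\<in>V. \<Sum>e | e \<in> E \<and> v \<in> e. 1)"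
    by (simp add: degree_def)
  also have "\<dots> = (\<Sum>e\<in>E. \<Sum>v | v \<in> V \<and> v \<in> e. 1)"
    using fin by (rule sum.swap_restrict)
  also have "\<dots> = (\<Sum>e\<in>E. 2)"
  proof (rule sum.cong[OF refl])
    fix e assume "e \<in> E"
    then have "{v \<in> V. v \<in> e} = e" "card e = 2" using assms by (auto simp: simple_graph_def)
    then show "(\<Sum>v | v \<in> V \<and> v \<in> e. 1) = (2::nat)" by simp
  qed
  finally show ?thesis by simp
qed

lemma connected_degree_pos:
  assumes conn: "connected_graph V E" and "2 \<le> card V" and v: "v \<in> V"
  shows "1 \<le> degree E v"
proof -
  have simple: "simple_graph V E" using conn by (simp add: connected_graph_def)
  have "\<not> V \<subseteq> {v}" using \<open>2 \<le> card V\<close> card_mono[of "{v}" V] by auto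
  then obtain w where w: "w \<in> V" "w \<noteq> v" by blast
  have "(v, w) \<in> (adjacency E)\<^sup>*" using conn v w by (auto simp: connected_graph_def)
  then obtain x where "(v, x) \<in> adjacency E" using w by (metis converse_rtranclE)
  then have "{v, x} \<in> {e \<in> E. v \<in> e}" by (simp add: adjacency_def)
  then show ?thesis
    using simple_graph_finite_edges[OF simple]
    by (auto simp: degree_def Suc_le_eq card_gt_0_iff)
qed

text \<open>
  A walk starting at \<open>v\<close> can only step to a neighbour of \<open>v\<close> and back, because each neighbour is a
  leaf. So the graph is a star centred at \<open>v\<close>.
\<close>

lemma card_le_if_all_others_leaves:
  assumes conn: "connected_graph V E" and v: "v \<in> V"
    and leaves: "\<And>w. w \<in> V \<Longrightarrow> w \<noteq> v \<Longrightarrow> degree E w = 1"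
  shows "card V \<le> degree E v + 1"
proof -
  have simple: "simple_graph V E" using conn by (simp add: connected_graph_def)
  have finE: "finite E" by (rule simple_graph_finite_edges[OF simple])
  have finV: "finite V" using simple by (simp add: simple_graph_def)
  have star: "w = v \<or> {v, w} \<in> E" if "(v, w) \<in> (adjacency E)\<^sup>*" for w
    using that
  proof (induction rule: rtrancl_induct)
    case base
    show ?case by simp
  next
    case (step w x)
    have wx: "{w, x} \<in> E" using step.hyps by (simp add: adjacency_def)
    show ?case
    proof (cases "w = v")
      case True
      then show ?thesis using wx by simp
    next
      case False
      then have vw: "{v, w} \<in> E" using step.IH by simp
      then have "w \<in> V" using simple by (auto simp: simple_graph_def)
      then have "card {e \<in> E. w \<in> e} = 1" using leaves False by (simp add: degree_def)
      then obtain e where e: "{e \<in> E. w \<in> e} = {e}" by (rule card_1_singletonE)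
      have "{v, w} \<in> {e}" "{w, x} \<in> {e}" unfolding e[symmetric] using vw wx by simp_all
      then have "{v, w} = {w, x}" by simp
      then show ?thesis using False by (auto simp: doubleton_eq_iff)
    qed
  qed
  have "card (V - {v}) \<le> card {e \<in> E. v \<in> e}"
  proof (rule card_inj_on_le)
    show "inj_on (\<lambda>w. {v, w}) (V - {v})" by (auto simp: inj_on_def doubleton_eq_iff)
    show "(\<lambda>w. {v, w}) ` (V - {v}) \<subseteq> {e \<in> E. v \<in> e}"
      using star conn v by (auto simp: connected_graph_def)
  qed (use finE in simp)
  then show ?thesis using finV v by (simp add: degree_def card_Diff_singleton)
qed

section \<open>Degree counts of a chemical graph\<close>

lemma chemical_degree_range:
  assumes "chemical_graph V E" and "2 \<le> card V" and "v \<in> V"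
  shows "degree E v \<in> {1, 2, 3, 4}"
proof -
  have "1 \<le> degree E v" "degree E v \<le> 4"
    using assms connected_degree_pos[of V E v] by (auto simp: chemical_graph_def)
  then show ?thesis by auto
qed

lemma chemical_finite: "chemical_graph V E \<Longrightarrow> finite V"
  by (simp add: chemical_graph_def connected_graph_def simple_graph_def)

lemma chemical_sum_degree_counts:
  fixes f :: "nat \<Rightarrow> 'a::comm_semiring_1"
  assumes "chemical_graph V E" and "2 \<le> card V"
  shows "(\<Sum>v\<in>V. f (degree E v)) =
    of_nat (degree_count V E 1) * f 1 + of_nat (degree_count V E 2) * f 2
    + of_nat (degree_count V E 3) * f 3 + of_nat (degree_count V E 4) * f 4"
proof -
  have "(\<Sum>v\<in>V. f (degree E v)) = (\<Sum>i\<in>{1,2,3,4}. \<Sum>v | v \<in> V \<and> degree E v = i. f (degree E v))"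
    by (rule sum.group[symmetric])
      (use chemical_finite[OF assms(1)] chemical_degree_range[OF assms] in auto)
  also have "\<dots> = (\<Sum>i\<in>{1,2,3,4}. of_nat (degree_count V E i) * f i)"
    by (rule sum.cong) (simp_all add: degree_count_def)
  finally show ?thesis by (simp add: add.assoc)
qed

lemma chemical_order_eq:
  assumes "chemical_graph V E" and "2 \<le> card V"
  shows "card V =
    degree_count V E 1 + degree_count V E 2 + degree_count V E 3 + degree_count V E 4"
  using chemical_sum_degree_counts[OF assms, of "\<lambda>_. 1::nat"] by simp

lemma chemical_size_eq:
  assumes "chemical_graph V E" and "2 \<le> card V"
  shows "2 * card E = degree_count V E 1 + 2 * degree_count V E 2
    + 3 * degree_count V E 3 + 4 * degree_count V E 4"
  using chemical_sum_degree_counts[OF assms, of "\<lambda>i. i"] handshake[of V E] assms(1)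
  by (simp add: chemical_graph_def connected_graph_def)

text \<open>The case distinction of the bounds is a constraint on the vertices of degree \<open>2\<close> and \<open>3\<close>.\<close>

lemma chemical_res3_eq:
  assumes "chemical_graph V E" and "2 \<le> card V"
  shows "res3 (card V) (card E) = int ((degree_count V E 2 + 2 * degree_count V E 3) mod 3)"
proof -
  have "2 * int (card E) - int (card V) =
      int (degree_count V E 2 + 2 * degree_count V E 3) + 3 * int (degree_count V E 4)"
    using chemical_order_eq[OF assms] chemical_size_eq[OF assms] by linarith
  then show ?thesis by (simp add: res3_def zmod_int)
qed

lemma mem_degree_set_iff:
  assumes "finite V"
  shows "i \<in> degree_set V E \<longleftrightarrow> 0 < degree_count V E i"
  using assms by (auto simp: degree_set_def degree_count_def card_gt_0_iff)

lemma at_most_one_middle_iff_extremal: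
  assumes chem: "chemical_graph V E" and "5 \<le> card V"
  shows "degree_count V E 2 + degree_count V E 3 \<le> 1 \<longleftrightarrow>
    extremal_degrees V E \<or> extremal_without_leaves V E"
proof -
  define c where "c = degree_count V E"
  have card2: "2 \<le> card V" using \<open>5 \<le> card V\<close> by simp
  have fin: "finite V" by (rule chemical_finite[OF chem])
  have "degree_set V E \<subseteq> {1, 2, 3, 4}"
    using chemical_degree_range[OF chem card2] by (auto simp: degree_set_def)
  then have set_eq: "degree_set V E = A \<longleftrightarrow>
      (1 \<in> A \<longleftrightarrow> 0 < c 1) \<and> (2 \<in> A \<longleftrightarrow> 0 < c 2) \<and> (3 \<in> A \<longleftrightarrow> 0 < c 3) \<and> (4 \<in> A \<longleftrightarrow> 0 < c 4)"
    if "A \<subseteq> {1, 2, 3, 4}" for A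
    using that unfolding c_def mem_degree_set_iff[OF fin, symmetric] by blast
  have res: "res3 (card V) (card E) = int ((c 2 + 2 * c 3) mod 3)"
    using chemical_res3_eq[OF chem card2] by (simp add: c_def)
  have size: "2 * card E = c 1 + 2 * c 2 + 3 * c 3 + 4 * c 4"
    using chemical_size_eq[OF chem card2] by (simp add: c_def)
  have counts: "card {v \<in> V. degree E v = i} = c i" for i by (simp add: c_def degree_count_def)
  have four: "0 < c 4" if few: "c 2 + c 3 \<le> 1"
  proof (rule ccontr)
    assume "\<not> 0 < c 4"
    then have "4 \<notin> degree_set V E" by (simp add: c_def mem_degree_set_iff[OF fin])
    then have range: "degree E v \<in> {1, 2, 3}" if "v \<in> V" for v
      using chemical_degree_range[OF chem card2 that] that by (auto simp: degree_set_def)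
    let ?M = "{v \<in> V. degree E v = 2} \<union> {v \<in> V. degree E v = 3}"
    have "card ?M \<le> 1"
      using few card_Un_le[of "{v \<in> V. degree E v = 2}" "{v \<in> V. degree E v = 3}"]
      by (simp add: counts)
    then have "\<exists>v\<in>V. ?M \<subseteq> {v}"
    proof (cases "?M = {}")
      case True
      moreover have "V \<noteq> {}" using \<open>5 \<le> card V\<close> by auto
      ultimately show ?thesis by blast
    next
      case False
      then obtain v where "v \<in> ?M" by blast
      moreover have "\<forall>x\<in>?M. \<forall>y\<in>?M. x = y"
        using \<open>card ?M \<le> 1\<close> fin card_le_Suc0_iff_eq[of ?M] by simp
      ultimately have "v \<in> V" "?M \<subseteq> {v}" by blast+
      then show ?thesis by blast
    qed
    then obtain v where v: "v \<in> V" "?M \<subseteq> {v}" by blast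
    have "card V \<le> degree E v + 1"
    proof (rule card_le_if_all_others_leaves)
      show "connected_graph V E" using chem by (simp add: chemical_graph_def)
      show "degree E w = 1" if "w \<in> V" "w \<noteq> v" for w
        using that range[of w] v by auto
    qed (rule v)
    then show False using range[OF v(1)] \<open>5 \<le> card V\<close> by auto
  qed
  show ?thesis
  proof
    assume "degree_count V E 2 + degree_count V E 3 \<le> 1"
    then have few: "c 2 + c 3 \<le> 1" by (simp add: c_def)
    then consider "c 2 = 0" "c 3 = 0" | "c 2 = 1" "c 3 = 0" | "c 2 = 0" "c 3 = 1" by linarith
    then show "extremal_degrees V E \<or> extremal_without_leaves V E"
    proof cases
      case 1
      then show ?thesis using four[OF few]
        by (auto simp: extremal_degrees_def extremal_without_leaves_def set_eq res counts)
    next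
      case 2
      then show ?thesis using four[OF few]
        by (auto simp: extremal_degrees_def extremal_without_leaves_def set_eq res counts)
    next
      case 3
      \<comment> \<open>Without leaves the degree sum would be \<open>3 + 4 * c 4\<close>, an odd number.\<close>
      then have "0 < c 1" using size by presburger
      with 3 show ?thesis using four[OF few]
        by (auto simp: extremal_degrees_def set_eq res counts)
    qed
  next
    assume "extremal_degrees V E \<or> extremal_without_leaves V E"
    then have "c 2 + c 3 \<le> 1"
      by (auto simp: extremal_degrees_def extremal_without_leaves_def set_eq counts
          split: if_splits)
    then show "degree_count V E 2 + degree_count V E 3 \<le> 1" by (simp add: c_def)
  qed
qed

section \<open>Extremal sums over the degrees\<close>

text \<open>
  Items of weight \<open>1\<close> and cost \<open>\<alpha>\<close> and items of weight \<open>2\<close> and cost \<open>\<beta>\<close> are to reach a total weight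
  with prescribed residue modulo \<open>3\<close>. The hypotheses say that one item is cheaper than two items of
  the other kind of the same residue; they also force both costs to be positive.
\<close>

lemma residue_cost:
  fixes x y :: nat and \<alpha> \<beta> :: real
  assumes "\<alpha> < 2 * \<beta>" and "\<beta> < 2 * \<alpha>"
  defines "r \<equiv> (x + 2 * y) mod 3"
  defines "g \<equiv> (if r = 1 then \<alpha> else if r = 2 then \<beta> else 0)"
  shows "g \<le> x * \<alpha> + y * \<beta>" and "x * \<alpha> + y * \<beta> = g \<longleftrightarrow> x + y \<le> 1"
proof -
  have pos: "0 < \<alpha>" "0 < \<beta>" using assms(1,2) by linarith+
  have few: "x * \<alpha> + y * \<beta> = g" if "x + y \<le> 1"
  proof -
    from that consider "x = 0" "y = 0" | "x = 1" "y = 0" | "x = 0" "y = 1" by linarith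
    then show ?thesis by cases (simp_all add: g_def r_def)
  qed
  have many: "g < x * \<alpha> + y * \<beta>" if "2 \<le> x + y"
  proof -
    have mono: "i * \<alpha> + j * \<beta> \<le> x * \<alpha> + y * \<beta>" if "i \<le> x" "j \<le> y" for i j :: nat
      using that pos by (intro add_mono mult_right_mono) auto
    consider "1 \<le> x" "1 \<le> y" | "2 \<le> x" "y = 0" | "x = 0" "2 \<le> y"
      using \<open>2 \<le> x + y\<close> by linarith
    then show ?thesis
    proof cases
      case 1
      have "g < \<alpha> + \<beta>" using pos by (simp add: g_def)
      also have "\<dots> \<le> x * \<alpha> + y * \<beta>" using mono[OF 1] by simp
      finally show ?thesis .
    next
      case 2
      have "g < 2 * \<alpha>" using pos assms(2) by (simp add: g_def)
      also have "\<dots> \<le> x * \<alpha> + y * \<beta>" using mono[of 2 0] \<open>2 \<le> x\<close> by simp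
      finally show ?thesis .
    next
      case 3
      have "g < 2 * \<beta>" using pos assms(1) by (simp add: g_def)
      also have "\<dots> \<le> x * \<alpha> + y * \<beta>" using mono[of 0 2] \<open>2 \<le> y\<close> by simp
      finally show ?thesis .
    qed
  qed
  show "g \<le> x * \<alpha> + y * \<beta>" using few many by (cases "x + y \<le> 1") auto
  show "x * \<alpha> + y * \<beta> = g \<longleftrightarrow> x + y \<le> 1" using few many by (cases "x + y \<le> 1") auto
qed

text \<open>
  The defect of \<open>f\<close> at a middle degree is measured against the affine function that agrees with \<open>f\<close>
  at the degrees \<open>1\<close> and \<open>4\<close>. The bound is the sum of this affine function, which depends only on
  order and size, minus the least defect compatible with the residue.
\<close>

lemma degree_sum_max:
  fixes f :: "nat \<Rightarrow> real" and \<alpha> \<beta> bound :: real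
  assumes chem: "chemical_graph V E" and "5 \<le> card V"
    and \<alpha>: "\<alpha> = (2 * f 1 + f 4) / 3 - f 2" and \<beta>: "\<beta> = (f 1 + 2 * f 4) / 3 - f 3"
    and costs: "\<alpha> < 2 * \<beta>" "\<beta> < 2 * \<alpha>"
    and bound: "bound = real (card V) * f 1 + (2 * real (card E) - real (card V)) * (f 4 - f 1) / 3
      - (if res3 (card V) (card E) = 1 then \<alpha>
         else if res3 (card V) (card E) = 2 then \<beta> else 0)"
  shows "(\<Sum>v\<in>V. f (degree E v)) \<le> bound"
    and "(\<Sum>v\<in>V. f (degree E v)) = bound \<longleftrightarrow>
      extremal_degrees V E \<or> extremal_without_leaves V E"
proof -
  define c where "c = degree_count V E"
  have card2: "2 \<le> card V" using \<open>5 \<le> card V\<close> by simp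
  define r where "r = (c 2 + 2 * c 3) mod 3"
  define g where "g = (if r = 1 then \<alpha> else if r = 2 then \<beta> else 0)"
  have res: "res3 (card V) (card E) = int r"
    using chemical_res3_eq[OF chem card2] by (simp add: c_def r_def)
  have order: "real (card V) = c 1 + c 2 + c 3 + c 4"
    using chemical_order_eq[OF chem card2] by (simp add: c_def)
  have "2 * card E = c 1 + 2 * c 2 + 3 * c 3 + 4 * c 4"
    using chemical_size_eq[OF chem card2] by (simp add: c_def)
  then have size: "2 * real (card E) = c 1 + 2 * c 2 + 3 * c 3 + 4 * c 4"
    by linarith
  have "(\<Sum>v\<in>V. f (degree E v)) = c 1 * f 1 + c 2 * f 2 + c 3 * f 3 + c 4 * f 4"
    using chemical_sum_degree_counts[OF chem card2, of f] by (simp add: c_def)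
  also have "\<dots> = real (card V) * f 1 + (2 * real (card E) - real (card V)) * (f 4 - f 1) / 3
      - (c 2 * \<alpha> + c 3 * \<beta>)"
    unfolding order size \<alpha> \<beta> by (simp add: field_simps)
  also have "\<dots> = bound + g - (c 2 * \<alpha> + c 3 * \<beta>)"
    by (simp add: bound g_def res)
  finally have sum: "(\<Sum>v\<in>V. f (degree E v)) = bound + g - (c 2 * \<alpha> + c 3 * \<beta>)" .
  note cost = residue_cost[OF costs, of "c 2" "c 3", folded r_def, folded g_def]
  show "(\<Sum>v\<in>V. f (degree E v)) \<le> bound"
    using sum cost(1) by linarith
  have "(\<Sum>v\<in>V. f (degree E v)) = bound \<longleftrightarrow> c 2 + c 3 \<le> 1"
    using sum cost(2) by linarith
  then show "(\<Sum>v\<in>V. f (degree E v)) = bound \<longleftrightarrow>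
      extremal_degrees V E \<or> extremal_without_leaves V E"
    using at_most_one_middle_iff_extremal[OF chem \<open>5 \<le> card V\<close>] by (simp add: c_def)
qed

section \<open>The Zagreb indices and the forgotten coindex\<close>

lemma log_2_of_4: "log 2 (4::real) = 2"
  using log_pow_cancel[of 2 2] by simp

lemma log_2_of_3_bounds: "3 / 2 < log 2 (3::real)" "log 2 (3::real) < 5 / 3"
proof -
  have "log 2 (2 ^ 3) < log 2 ((3::real) ^ 2)" by simp
  then show "3 / 2 < log 2 (3::real)" by (simp only: log_nat_power) simp
  have "log 2 ((3::real) ^ 3) < log 2 (2 ^ 5)" by simp
  then show "log 2 (3::real) < 5 / 3" by (simp only: log_nat_power) simp
qed

lemma powr_eq_2_powr: "0 < x \<Longrightarrow> x powr b = 2 powr (b * log 2 x)" for x b :: real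
  by (simp add: powr_def log_def)

lemma Pi1_eq_2_powr:
  assumes "chemical_graph V E" and "2 \<le> card V"
  shows "Pi1 a V E = 2 powr (a * (\<Sum>v\<in>V. log 2 (degree E v)))"
proof -
  have "Pi1 a V E = (\<Prod>v\<in>V. 2 powr (a * log 2 (degree E v)))"
    unfolding Pi1_def using chemical_degree_range[OF assms]
    by (intro prod.cong refl powr_eq_2_powr) force
  then show ?thesis
    by (simp add: powr_sum sum_distrib_left chemical_finite[OF assms(1)])
qed

lemma Pi2_eq_2_powr:
  assumes "chemical_graph V E" and "2 \<le> card V"
  shows "Pi2 a V E = 2 powr (a * (\<Sum>v\<in>V. degree E v * log 2 (degree E v)))"
proof -
  have "Pi2 a V E = (\<Prod>v\<in>V. 2 powr (a * degree E v * log 2 (degree E v)))"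
    unfolding Pi2_def using chemical_degree_range[OF assms]
    by (intro prod.cong refl powr_eq_2_powr) force
  then show ?thesis
    by (simp add: powr_sum sum_distrib_left mult.assoc chemical_finite[OF assms(1)])
qed

text \<open>
  The exponents below are the values at \<open>a = 1\<close> of the binary logarithms of the two bounds; the
  factors \<open>3 powr a\<close> and \<open>3 powr (3 * a)\<close> contribute the multiples of \<open>log 2 3\<close>.
\<close>

definition P_exponent :: "nat \<Rightarrow> nat \<Rightarrow> real" where
  "P_exponent n m =
    (if res3 n m = 1 then (4 * real m - 2 * real n + 1) / 3
     else if res3 n m = 2 then 2 * (2 * real m - real n - 2) / 3 + log 2 3
     else 2 * (2 * real m - real n) / 3)"

definition Q_exponent :: "nat \<Rightarrow> nat \<Rightarrow> real" where
  "Q_exponent n m =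
    (if res3 n m = 1 then 2 * (8 * real m - 4 * real n - 1) / 3
     else if res3 n m = 2 then 8 * (2 * real m - real n - 2) / 3 + 3 * log 2 3
     else 8 * (2 * real m - real n) / 3)"

lemma three_powr: "3 powr b = 2 powr (b * log 2 3)" for b :: real
  by (rule powr_eq_2_powr) simp

lemma P_bound_eq_2_powr: "P_bound a n m = 2 powr (a * P_exponent n m)"
  unfolding P_bound_def P_exponent_def three_powr powr_add[symmetric]
  by (auto, (rule arg_cong[where f = "(powr) 2"], simp add: field_simps)+)

lemma Q_bound_eq_2_powr: "Q_bound a n m = 2 powr (a * Q_exponent n m)"
  unfolding Q_bound_def Q_exponent_def three_powr powr_add[symmetric]
  by (auto, (rule arg_cong[where f = "(powr) 2"], simp add: field_simps)+)

lemma sum_log_degree_min: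
  assumes "chemical_graph V E" and "5 \<le> card V"
  shows "P_exponent (card V) (card E) \<le> (\<Sum>v\<in>V. log 2 (degree E v))"
    and "(\<Sum>v\<in>V. log 2 (degree E v)) = P_exponent (card V) (card E) \<longleftrightarrow>
      extremal_degrees V E \<or> extremal_without_leaves V E"
proof -
  let ?f = "\<lambda>d. - log 2 (real d)"
  let ?\<alpha> = "1 / 3 :: real" and ?\<beta> = "log 2 3 - 4 / 3 :: real"
  have \<alpha>: "?\<alpha> = (2 * ?f 1 + ?f 4) / 3 - ?f 2" and \<beta>: "?\<beta> = (?f 1 + 2 * ?f 4) / 3 - ?f 3"
    by (simp_all add: log_2_of_4)
  have costs: "?\<alpha> < 2 * ?\<beta>" "?\<beta> < 2 * ?\<alpha>" using log_2_of_3_bounds by simp_all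
  have bound: "- P_exponent (card V) (card E) =
      real (card V) * ?f 1 + (2 * real (card E) - real (card V)) * (?f 4 - ?f 1) / 3
      - (if res3 (card V) (card E) = 1 then ?\<alpha>
         else if res3 (card V) (card E) = 2 then ?\<beta> else 0)"
    by (auto simp: P_exponent_def log_2_of_4 diff_divide_distrib add_divide_distrib)
  note max = degree_sum_max[where f = ?f, OF assms \<alpha> \<beta> costs bound]
  show "P_exponent (card V) (card E) \<le> (\<Sum>v\<in>V. log 2 (degree E v))"
    using max(1) by (simp add: sum_negf)
  show "(\<Sum>v\<in>V. log 2 (degree E v)) = P_exponent (card V) (card E) \<longleftrightarrow>
      extremal_degrees V E \<or> extremal_without_leaves V E"
    using max(2) by (simp add: sum_negf)
qed

lemma sum_degree_log_degree_max:
  assumes "chemical_graph V E" and "5 \<le> card V"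
  shows "(\<Sum>v\<in>V. degree E v * log 2 (degree E v)) \<le> Q_exponent (card V) (card E)"
    and "(\<Sum>v\<in>V. degree E v * log 2 (degree E v)) = Q_exponent (card V) (card E) \<longleftrightarrow>
      extremal_degrees V E \<or> extremal_without_leaves V E"
proof -
  let ?f = "\<lambda>d. real d * log 2 (real d)"
  let ?\<alpha> = "2 / 3 :: real" and ?\<beta> = "16 / 3 - 3 * log 2 3 :: real"
  have \<alpha>: "?\<alpha> = (2 * ?f 1 + ?f 4) / 3 - ?f 2" and \<beta>: "?\<beta> = (?f 1 + 2 * ?f 4) / 3 - ?f 3"
    by (simp_all add: log_2_of_4)
  have costs: "?\<alpha> < 2 * ?\<beta>" "?\<beta> < 2 * ?\<alpha>" using log_2_of_3_bounds by simp_all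
  have bound: "Q_exponent (card V) (card E) =
      real (card V) * ?f 1 + (2 * real (card E) - real (card V)) * (?f 4 - ?f 1) / 3
      - (if res3 (card V) (card E) = 1 then ?\<alpha>
         else if res3 (card V) (card E) = 2 then ?\<beta> else 0)"
    by (auto simp: Q_exponent_def log_2_of_4 diff_divide_distrib add_divide_distrib)
  note max = degree_sum_max[where f = ?f, OF assms \<alpha> \<beta> costs bound]
  show "(\<Sum>v\<in>V. degree E v * log 2 (degree E v)) \<le> Q_exponent (card V) (card E)"
    using max(1) .
  show "(\<Sum>v\<in>V. degree E v * log 2 (degree E v)) = Q_exponent (card V) (card E) \<longleftrightarrow>
      extremal_degrees V E \<or> extremal_without_leaves V E"
    using max(2) .
qed

lemma forgotten_coindex_max:
  assumes chem: "chemical_graph V E" and "11 \<le> card V"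
  shows "forgotten_coindex V E \<le> F_bound (card V) (card E)"
    and "forgotten_coindex V E = F_bound (card V) (card E) \<longleftrightarrow>
      extremal_degrees V E \<or> extremal_without_leaves V E"
proof -
  have card5: "5 \<le> card V" using \<open>11 \<le> card V\<close> by simp
  let ?f = "\<lambda>d. (real (card V) - 1 - real d) * (real d)\<^sup>2"
  let ?\<alpha> = "2 * real (card V) - 16" and ?\<beta> = "2 * real (card V) - 18"
  have \<alpha>: "?\<alpha> = (2 * ?f 1 + ?f 4) / 3 - ?f 2" and \<beta>: "?\<beta> = (?f 1 + 2 * ?f 4) / 3 - ?f 3"
    by (simp_all add: field_simps)
  have costs: "?\<alpha> < 2 * ?\<beta>" "?\<beta> < 2 * ?\<alpha>" using \<open>11 \<le> card V\<close> by simp_all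
  have bound: "real_of_int (F_bound (card V) (card E)) =
      real (card V) * ?f 1 + (2 * real (card E) - real (card V)) * (?f 4 - ?f 1) / 3
      - (if res3 (card V) (card E) = 1 then ?\<alpha>
         else if res3 (card V) (card E) = 2 then ?\<beta> else 0)"
    by (simp add: F_bound_def Let_def field_simps)
  note max = degree_sum_max[where f = ?f, OF chem card5 \<alpha> \<beta> costs bound]
  have sum: "(\<Sum>v\<in>V. ?f (degree E v)) = real_of_int (forgotten_coindex V E)"
    by (simp add: forgotten_coindex_def)
  show "forgotten_coindex V E \<le> F_bound (card V) (card E)"
    using max(1) unfolding sum by simp
  show "forgotten_coindex V E = F_bound (card V) (card E) \<longleftrightarrow>
      extremal_degrees V E \<or> extremal_without_leaves V E"
    using max(2) unfolding sum by simp
qed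

theorem corollary4:
  fixes V :: "'v set" and E :: "'v set set" and n m :: nat
  assumes "chemical_graph V E"
    and "card V = n" and "card E = m"
    and "n \<ge> 5"
  shows "(\<forall>a::real. a < 0 \<longrightarrow> Pi1 a V E \<le> P_bound a n m \<and> Pi2 a V E \<ge> Q_bound a n m) \<and>
    (\<forall>a::real. a > 0 \<longrightarrow> Pi1 a V E \<ge> P_bound a n m \<and> Pi2 a V E \<le> Q_bound a n m) \<and>
    (\<forall>a::real. a \<noteq> 0 \<longrightarrow>
       (Pi1 a V E = P_bound a n m \<longleftrightarrow> extremal_degrees V E \<or> extremal_without_leaves V E) \<and>
       (Pi2 a V E = Q_bound a n m \<longleftrightarrow> extremal_degrees V E \<or> extremal_without_leaves V E)) \<and>
    (n \<ge> 11 \<longrightarrow>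
       forgotten_coindex V E \<le> F_bound n m \<and>
       (forgotten_coindex V E = F_bound n m \<longleftrightarrow>
          extremal_degrees V E \<or> extremal_without_leaves V E))"
proof -
  have card5: "5 \<le> card V" and card2: "2 \<le> card V" using assms by auto
  note log_min = sum_log_degree_min[OF assms(1) card5, unfolded assms(2,3)]
  note log_max = sum_degree_log_degree_max[OF assms(1) card5, unfolded assms(2,3)]
  note coindex = forgotten_coindex_max[OF assms(1), unfolded assms(2,3)]
  have first: "Pi1 a V E = 2 powr (a * (\<Sum>v\<in>V. log 2 (degree E v)))" for a
    by (rule Pi1_eq_2_powr[OF assms(1) card2])
  have second: "Pi2 a V E = 2 powr (a * (\<Sum>v\<in>V. degree E v * log 2 (degree E v)))" for a
    by (rule Pi2_eq_2_powr[OF assms(1) card2])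
  note as_powers = first second P_bound_eq_2_powr Q_bound_eq_2_powr
  have "Pi1 a V E \<le> P_bound a n m \<and> Q_bound a n m \<le> Pi2 a V E" if "a < 0" for a
    using log_min(1) log_max(1) that by (simp add: as_powers mult_left_mono_neg)
  moreover have "P_bound a n m \<le> Pi1 a V E \<and> Pi2 a V E \<le> Q_bound a n m" if "a > 0" for a
    using log_min(1) log_max(1) that by (simp add: as_powers)
  moreover have "(Pi1 a V E = P_bound a n m \<longleftrightarrow> extremal_degrees V E \<or> extremal_without_leaves V E) \<and>
      (Pi2 a V E = Q_bound a n m \<longleftrightarrow> extremal_degrees V E \<or> extremal_without_leaves V E)"
    if "a \<noteq> 0" for a
    using that by (simp add: as_powers powr_inj log_min(2) log_max(2))
  ultimately show ?thesis
    using coindex by blast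
qed

end
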